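(* Let $\sigma_A,\sigma_B,V_0,T>0$, $\rho\in(-1,1)$, and let $R,C,r_f,r_A,r_B$ be real parameters. Put $\phi=(\sigma_A^2+\sigma_B^2-2\rho\sigma_A\sigma_B)/8$ and $$v_{GG}=e^{\rho\sigma_A\sigma_B T}-e^{-2\phi T},\qquad v_{AA}=\tfrac14\bigl[e^{\sigma_A^2T}+e^{\sigma_B^2T}+2e^{\rho\sigma_A\sigma_BT}-4\bigr],$$ $$v_{GA}=\tfrac12\bigl[e^{(3\sigma_A^2-\sigma_B^2+6\rho\sigma_A\sigma_B)T/8}+e^{(-\sigma_A^2+3\sigma_B^2+6\rho\sigma_A\sigma_B)T/8}-2e^{-\phi T}\bigr],$$ $$\mu_0=V_0(e^{-\phi T}-1)+RT+Cr_fT,\qquad c=\tfrac{V_0}{2}(r_A+r_B)T .$$ For the hedge ratio $h\in[0,1]$ define $$\mathrm{SR}(h)=\frac{\mu_0-ch}{V_0\sqrt{v_{GG}+h^2v_{AA}-2h\,v_{GA}}}.$$ Assume $\mu_0>0$ (the strategy is profitable at $h=0$) and $c>0$ (borrowing is costly). Then the unconstrained maximizer of $\mathrm{SR}(h)$ (the maximizer when the liquidation-probability constraint is ignored) satisfies the linear first-order condition $$h\,(\mu_0v_{AA}-c\,v_{GA})=\mu_0v_{GA}-c\,v_{GG},$$ with unique solution $$h^{*}=\frac{\mu_0v_{GA}-c\,v_{GG}}{\mu_0v_{AA}-c\,v_{GA}}.$$ When borrowing is free ($c=0$), this reduces to the minimum-variance hedge ratio $h_{\mathrm{mv}}=v_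{GA}/v_{AA}$.
   Context: Two token prices follow correlated driftless geometric Brownian motions $dS^i_t/S^i_t=\sigma_i\,dW^i_t$, $i\in\{A,B\}$, with $dW^A_t\,dW^B_t=\rho\,dt$. With price relatives $p_i=S^i_T/S^i_0$, $G=\sqrt{p_Ap_B}$ and $A=\tfrac12(p_A+p_B)$, the quantities $v_{GG}$, $v_{AA}$, $v_{GA}$ are $\mathrm{Var}(G)$, $\mathrm{Var}(A)$, $\mathrm{Cov}(G,A)$. A liquidity provider with hedge ratio $h\in[0,1]$ has profit and loss over $[0,T]$ $$\Pi_T-\Pi_0=V_0(\sqrt{p_Ap_B}-1)+RT+Cr_fT-\tfrac{hV_0}{2}(p_A+p_B-2)-\tfrac{hV_0}{2}(r_A+r_B)T,$$ where $V_0$ is the initial value of the liquidity position, $R$ the reward rate (dollars per year), $C$ the collateral, $r_f$ the yield on the collateral, and $r_A,r_B$ the borrow rates. Then $\mathbb{E}[\Pi_T-\Pi_0]=\mu_0-ch$, $\mathrm{Var}(\Pi_T)=V_0^2[v_{GG}+h^2v_{AA}-2hv_{GA}]$, and $\mathrm{SR}(h)=\mathbb{E}[\Pi_T-\Pi_0]/\sqrt{\mathrm{Var}(\Pi_T)}$ is the Sharpe ratio. The full problem is to maximize $\mathrm{SR}(h)$ over $h\in[0,1]$ subject to an upper bound on the probability of liquidation (the loan-to-value ratio exceeding a threshold at some time in $[0,T]$); "unconstrained" means that this liquidation constraint is dropped. The minimum-variance hedge ratio $h_{\mathrm{mv}}$ is the minimizer of the convex quadratic $v_{GG}+h^2v_{AA}-2hv_{GA}$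 in $h$.
   Formalization: The first-order condition and unique solvability are claimed for a maximizer over [0,1] only if it is not h=0 (and for any maximizer over all real h), since with c·v_GG > μ0·v_GA the maximizer over [0,1] is h=0 and violates the condition. *)

theory Defs
  imports Complex_Main
begin

text \<open>
  Parameters throughout: volatilities \<open>\<sigma>A\<close>, \<open>\<sigma>B\<close>, correlation \<open>\<rho>\<close>, horizon \<open>T\<close>, initial position
  value \<open>V0\<close>, reward rate \<open>R\<close>, collateral \<open>C\<close>, collateral yield \<open>rf\<close>, borrow rates \<open>rA\<close>, \<open>rB\<close>.
  With \<open>G\<close> and \<open>A\<close> the geometric and arithmetic mean of the two price relatives at time \<open>T\<close>,
  \<open>v_GG\<close>, \<open>v_AA\<close>, \<open>v_GA\<close> are the closed forms of Var(G), Var(A), Cov(G,A), and the mean of \<open>G\<close>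
  is \<open>exp (- phi \<sigma>A \<sigma>B \<rho> * T)\<close>.
\<close>

definition phi :: "real \<Rightarrow> real \<Rightarrow> real \<Rightarrow> real" where
  "phi \<sigma>A \<sigma>B \<rho> = (\<sigma>A\<^sup>2 + \<sigma>B\<^sup>2 - 2 * \<rho> * \<sigma>A * \<sigma>B) / 8"

definition v_GG :: "real \<Rightarrow> real \<Rightarrow> real \<Rightarrow> real \<Rightarrow> real" where
  "v_GG \<sigma>A \<sigma>B \<rho> T = exp (\<rho> * \<sigma>A * \<sigma>B * T) - exp (- 2 * phi \<sigma>A \<sigma>B \<rho> * T)"

definition v_AA :: "real \<Rightarrow> real \<Rightarrow> real \<Rightarrow> real \<Rightarrow> real" where
  "v_AA \<sigma>A \<sigma>B \<rho> T =
     (1/4) * (exp (\<sigma>A\<^sup>2 * T) + exp (\<sigma>B\<^sup>2 * T) + 2 * exp (\<rho> * \<sigma>A * \<sigma>B * T) - 4)"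

definition v_GA :: "real \<Rightarrow> real \<Rightarrow> real \<Rightarrow> real \<Rightarrow> real" where
  "v_GA \<sigma>A \<sigma>B \<rho> T =
     (1/2) * (exp ((3 * \<sigma>A\<^sup>2 - \<sigma>B\<^sup>2 + 6 * \<rho> * \<sigma>A * \<sigma>B) * T / 8)
            + exp ((- \<sigma>A\<^sup>2 + 3 * \<sigma>B\<^sup>2 + 6 * \<rho> * \<sigma>A * \<sigma>B) * T / 8)
            - 2 * exp (- phi \<sigma>A \<sigma>B \<rho> * T))"

text \<open>Variance of the hedged position at hedge ratio \<open>h\<close>, per unit of \<open>V0\<^sup>2\<close>.\<close>

definition hedge_var :: "real \<Rightarrow> real \<Rightarrow> real \<Rightarrow> real \<Rightarrow> real \<Rightarrow> real" where
  "hedge_var \<sigma>A \<sigma>B \<rho> T h =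
     v_GG \<sigma>A \<sigma>B \<rho> T + h\<^sup>2 * v_AA \<sigma>A \<sigma>B \<rho> T - 2 * h * v_GA \<sigma>A \<sigma>B \<rho> T"

text \<open>The expected profit and loss at hedge ratio \<open>h\<close> is \<open>mu0 - borrow_cost * h\<close>.\<close>

definition mu0 ::
  "real \<Rightarrow> real \<Rightarrow> real \<Rightarrow> real \<Rightarrow> real \<Rightarrow> real \<Rightarrow> real \<Rightarrow> real \<Rightarrow> real" where
  "mu0 \<sigma>A \<sigma>B \<rho> V0 T R C rf = V0 * (exp (- phi \<sigma>A \<sigma>B \<rho> * T) - 1) + R * T + C * rf * T"

definition borrow_cost :: "real \<Rightarrow> real \<Rightarrow> real \<Rightarrow> real \<Rightarrow> real" where
  "borrow_cost V0 T rA rB = (V0 / 2) * (rA + rB) * T"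

definition sharpe_ratio ::
  "real \<Rightarrow> real \<Rightarrow> real \<Rightarrow> real \<Rightarrow> real \<Rightarrow> real \<Rightarrow> real \<Rightarrow> real \<Rightarrow> real \<Rightarrow> real \<Rightarrow> real \<Rightarrow> real" where
  "sharpe_ratio \<sigma>A \<sigma>B \<rho> V0 T R C rf rA rB h =
     (mu0 \<sigma>A \<sigma>B \<rho> V0 T R C rf - borrow_cost V0 T rA rB * h)
       / (V0 * sqrt (hedge_var \<sigma>A \<sigma>B \<rho> T h))"

definition h_mv :: "real \<Rightarrow> real \<Rightarrow> real \<Rightarrow> real \<Rightarrow> real" where
  "h_mv \<sigma>A \<sigma>B \<rho> T = arg_min (hedge_var \<sigma>A \<sigma>B \<rho> T) (\<lambda>_. True)"

end

theory Submission
  imports Defs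
begin

text \<open>
  The mean of the position is affine in \<open>h\<close> and its variance is a quadratic in \<open>h\<close>, so the derivative
  of the Sharpe ratio has the sign of \<open>F h = (\<mu> vGA - c vGG) - h (\<mu> vAA - c vGA)\<close>: the quadratic terms
  cancel. Interior maximizers are therefore zeros of \<open>F\<close>. The right end \<open>h = 1\<close> is never optimal
  because \<open>vGA < vAA\<close>: with \<open>f = phi T\<close>, AM-GM gives \<open>vAA \<ge> exp f * vGA\<close>.
  The variance is positive by the Cauchy-Schwarz inequality for the power series of \<open>exp\<close>.
\<close>

section \<open>Maximizing an affine function over the root of a quadratic\<close>

locale affine_over_sqrt_quadratic =
  fixes G A B \<mu> c V :: real
  assumes quad_pos: "\<And>h. G + h\<^sup>2 * A - 2 * h * B > 0"
    and A_pos: "A > 0" and \<mu>_pos: "\<mu> > 0" and V_pos: "V > 0"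
begin

definition Q :: "real \<Rightarrow> real" where "Q h = G + h\<^sup>2 * A - 2 * h * B"

definition ratio :: "real \<Rightarrow> real" where "ratio h = (\<mu> - c * h) / (V * sqrt (Q h))"

text \<open>The derivative of \<open>ratio\<close> has numerator \<open>L - h * K\<close>. Both
  coefficients are linear in \<open>\<mu>\<close> and \<open>c\<close>, and
  \<open>A * G - B\<^sup>2\<close> is the determinant of this dependence up to sign.\<close>

definition K :: real where "K = \<mu> * A - c * B"

definition L :: real where "L = \<mu> * B - c * G"

lemma Q_pos: "Q h > 0"
  using quad_pos by (simp add: Q_def)

text \<open>Evaluate the positive quadratic at its vertex \<open>B / A\<close>.\<close>

lemma discriminant_pos: "A * G - B\<^sup>2 > 0"
proof -
  have "A * Q (B / A) > 0" using Q_pos A_pos by simp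
  moreover have "A * Q (B / A) = A * G - B\<^sup>2"
    using A_pos by (simp add: Q_def field_simps power2_eq_square)
  ultimately show ?thesis by simp
qed

lemma ratio_deriv:
  "(ratio has_real_derivative (L - h * K) / (V * (sqrt (Q h)) ^ 3)) (at h)"
proof -
  define q where "q = sqrt (Q h)"
  have q: "q > 0" "q\<^sup>2 = Q h" using Q_pos[of h] by (auto simp: q_def)
  have dQ: "(Q has_real_derivative 2 * h * A - 2 * B) (at h)"
    unfolding Q_def by (auto intro!: derivative_eq_intros)
  have dS: "((\<lambda>x. V * sqrt (Q x)) has_real_derivative V * ((2 * h * A - 2 * B) * (inverse q / 2))) (at h)"
    by (rule DERIV_cmult)
      (use DERIV_chain2[OF DERIV_real_sqrt dQ] Q_pos[of h] in \<open>simp add: q_def mult_ac\<close>)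
  have dN: "((\<lambda>x. \<mu> - c * x) has_real_derivative - c) (at h)"
    by (auto intro!: derivative_eq_intros)
  have "(ratio has_real_derivative
      (- c * (V * q) - (\<mu> - c * h) * (V * ((2 * h * A - 2 * B) * (inverse q / 2)))) / ((V * q) * (V * q))) (at h)"
    unfolding ratio_def q_def
    by (rule DERIV_divide[OF dN dS[unfolded q_def]]) (use V_pos Q_pos[of h] in simp)
  \<comment> \<open>Expanding by \<open>q / V\<close> leaves only \<open>q\<^sup>2 = Q h\<close> in
    the numerator.\<close>
  moreover have "(- c * (V * q) - (\<mu> - c * h) * (V * ((2 * h * A - 2 * B) * (inverse q / 2)))) / ((V * q) * (V * q))
      = (- c * q\<^sup>2 - (\<mu> - c * h) * (h * A - B)) / (V * q ^ 3)"
    using q(1) V_pos by (simp add: field_simps power2_eq_square power3_eq_cube)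
  moreover have "- c * q\<^sup>2 - (\<mu> - c * h) * (h * A - B) = L - h * K"
    unfolding q(2) Q_def L_def K_def by (simp add: algebra_simps power2_eq_square)
  ultimately show ?thesis by (simp add: q_def)
qed

lemma deriv_denom_pos: "V * (sqrt (Q h)) ^ 3 > 0"
  using V_pos Q_pos[of h] by simp

lemma continuous_on_ratio: "continuous_on S ratio"
  by (meson DERIV_isCont continuous_at_imp_continuous_on ratio_deriv)

section \<open>Critical points of the ratio\<close>

lemma local_max_first_order:
  assumes "d > 0" and "\<And>y. \<bar>h - y\<bar> < d \<Longrightarrow> ratio y \<le> ratio h"
  shows "h * K = L"
proof -
  have "(L - h * K) / (V * (sqrt (Q h)) ^ 3) = 0"
    using DERIV_local_max[OF ratio_deriv assms(1)] assms(2) by blast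
  with V_pos Q_pos[of h] show ?thesis by simp
qed

text \<open>If \<open>K\<close> vanished, so would \<open>L\<close>; eliminating \<open>c\<close>
  between them would make \<open>\<mu>\<close> times the positive discriminant zero.\<close>

lemma first_order_imp_K_nonzero:
  assumes "h * K = L" shows "K \<noteq> 0"
proof
  assume "K = 0"
  with assms have "L = 0" by simp
  have "\<mu> * (A * G - B\<^sup>2) = K * G - L * B"
    by (simp add: K_def L_def algebra_simps power2_eq_square)
  with \<open>K = 0\<close> \<open>L = 0\<close> \<mu>_pos discriminant_pos show False by simp
qed

text \<open>At a critical point \<open>K * Q h\<close> equals \<open>\<mu> - c * h\<close> times the
  discriminant, so \<open>K\<close> has the sign of the mean.\<close>

lemma first_order_imp_K_pos:
  assumes "h * K = L" and "\<mu> - c * h > 0" shows "K > 0"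
proof -
  have det: "K * G - L * B = \<mu> * (A * G - B\<^sup>2)" "L * A - K * B = - c * (A * G - B\<^sup>2)"
    by (simp_all add: K_def L_def algebra_simps power2_eq_square)
  have "(K * G - L * B) + h * (L * A - K * B) = (\<mu> - c * h) * (A * G - B\<^sup>2)"
    unfolding det by (simp add: algebra_simps)
  moreover have "(K * G - L * B) + h * (L * A - K * B) = K * Q h"
    unfolding assms(1)[symmetric] Q_def by (simp add: algebra_simps power2_eq_square)
  ultimately have "K * Q h > 0" using assms(2) discriminant_pos by simp
  then show ?thesis using Q_pos[of h] by (simp add: zero_less_mult_iff)
qed

section \<open>Maximizers on the unit interval\<close>

lemma numerator_pos_at_max:
  assumes "ratio h \<ge> ratio 0" shows "\<mu> - c * h > 0"
proof -
  have "ratio 0 > 0" using \<mu>_pos V_pos Q_pos[of 0] by (simp add: ratio_def)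
  with assms have "ratio h > 0" by simp
  moreover have "V * sqrt (Q h) > 0" using V_pos Q_pos[of h] by simp
  ultimately show ?thesis
    unfolding ratio_def by (metis less_asym zero_less_divide_iff)
qed

text \<open>The derivative at \<open>1\<close> has numerator
  \<open>- c * Q 1 - (\<mu> - c) * (A - B) < 0\<close>, so \<open>ratio\<close> is larger just to
  the left.\<close>

lemma max_not_right_end:
  assumes "c > 0" and "B < A" and max: "\<And>y. y \<in> {0..1} \<Longrightarrow> ratio y \<le> ratio 1"
  shows False
proof -
  have N: "\<mu> - c > 0" using numerator_pos_at_max[of 1] max[of 0] by simp
  have "L - 1 * K = - c * Q 1 - (\<mu> - c) * (A - B)"
    by (simp add: L_def K_def Q_def algebra_simps)
  moreover have "c * Q 1 > 0" "(\<mu> - c) * (A - B) > 0" using assms N Q_pos[of 1] by simp_all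
  ultimately have "(L - 1 * K) / (V * (sqrt (Q 1)) ^ 3) < 0"
    using deriv_denom_pos[of 1] by (intro divide_neg_pos) linarith+
  from DERIV_neg_dec_left[OF ratio_deriv this]
  obtain d where d: "d > 0" "\<And>k. 0 < k \<Longrightarrow> k < d \<Longrightarrow> ratio 1 < ratio (1 - k)" by auto
  have "ratio 1 < ratio (1 - min (d / 2) 1)" using d by simp
  moreover have "ratio (1 - min (d / 2) 1) \<le> ratio 1" using d(1) by (intro max) auto
  ultimately show False by simp
qed

lemma max_unit_first_order:
  assumes "c > 0" and "B < A" and "h \<in> {0..1}" and "h \<noteq> 0"
    and max: "\<And>y. y \<in> {0..1} \<Longrightarrow> ratio y \<le> ratio h"
  shows "h * K = L"
proof -
  have "h \<noteq> 1" using max_not_right_end assms by blast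
  with assms have "0 < h" "h < 1" by auto
  \<comment> \<open>The radius is the distance from \<open>h\<close> to the nearer endpoint.\<close>
  then show ?thesis
    by (intro local_max_first_order[of "min h (1 - h)"] max) auto
qed

text \<open>A second maximizer would be interior with \<open>K > 0\<close>, so
  \<open>L = h * K > 0\<close>. But \<open>L\<close> has the sign of the derivative at
  \<open>0\<close>, so \<open>ratio\<close> would increase to the right of \<open>0\<close>.\<close>

lemma left_end_max_unique:
  assumes "c > 0" and "B < A" and "h \<in> {0..1}"
    and max: "\<And>y. y \<in> {0..1} \<Longrightarrow> ratio y \<le> ratio h"
    and max0: "\<And>y. y \<in> {0..1} \<Longrightarrow> ratio y \<le> ratio 0"
  shows "h = 0"
proof (rule ccontr)
  assume h: "h \<noteq> 0"
  have foc: "h * K = L" using max_unit_first_order assms h by blast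
  have "K > 0" using first_order_imp_K_pos[OF foc] numerator_pos_at_max max by simp
  with foc h \<open>h \<in> {0..1}\<close> have "L > 0" by (metis atLeastAtMost_iff less_eq_real_def mult_pos_pos)
  then have "(L - 0 * K) / (V * (sqrt (Q 0)) ^ 3) > 0" using deriv_denom_pos[of 0] by simp
  from DERIV_pos_inc_right[OF ratio_deriv this]
  obtain d where d: "d > 0" "\<And>k. 0 < k \<Longrightarrow> k < d \<Longrightarrow> ratio 0 < ratio (0 + k)" by blast
  have "ratio 0 < ratio (min (d / 2) 1)" using d(1) d(2)[of "min (d / 2) 1"] by simp
  moreover have "ratio (min (d / 2) 1) \<le> ratio 0" using d(1) by (intro max0) auto
  ultimately show False by simp
qed

text \<open>Existence is compactness. Two nonzero maximizers solve the same nondegenerate linear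
  equation, and a maximizer at \<open>0\<close> excludes any other.\<close>

lemma ex1_max_unit:
  assumes "c > 0" and "B < A"
  shows "\<exists>!h. is_arg_max ratio (\<lambda>x. x \<in> {0..1}) h"
proof -
  obtain h where h: "h \<in> {0..1}" "\<And>y. y \<in> {0..1} \<Longrightarrow> ratio y \<le> ratio h"
    using continuous_attains_sup[of "{0..1}" ratio] continuous_on_ratio by auto
  show ?thesis
  proof (rule ex1I[of _ h])
    show "is_arg_max ratio (\<lambda>x. x \<in> {0..1}) h"
      using h by (force simp: is_arg_max_linorder)
  next
    fix g assume "is_arg_max ratio (\<lambda>x. x \<in> {0..1}) g"
    then have g: "g \<in> {0..1}" "\<And>y. y \<in> {0..1} \<Longrightarrow> ratio y \<le> ratio g"
      by (auto simp: is_arg_max_linorder)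
    show "g = h"
    proof (cases "g = 0 \<or> h = 0")
      case True
      then show ?thesis using left_end_max_unique[OF assms] g h by metis
    next
      case False
      then have "g * K = L" "h * K = L"
        using max_unit_first_order[OF assms] g h by blast+
      then show ?thesis using first_order_imp_K_nonzero[of h] by (metis mult_cancel_right)
    qed
  qed
qed

end

section \<open>Minimizing a convex quadratic by completing the square\<close>

lemma is_arg_min_quadratic_iff:
  fixes G A B :: real
  assumes "A > 0"
  shows "is_arg_min (\<lambda>h. G + h\<^sup>2 * A - 2 * h * B) (\<lambda>_. True) h \<longleftrightarrow> h = B / A"
proof -
  have sq: "G + x\<^sup>2 * A - 2 * x * B = A * (x - B / A)\<^sup>2 + (G - B\<^sup>2 / A)" for x
    using assms by (simp add: field_simps power2_eq_square)
  show ?thesis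
  proof
    assume "is_arg_min (\<lambda>h. G + h\<^sup>2 * A - 2 * h * B) (\<lambda>_. True) h"
    then have "A * (h - B / A)\<^sup>2 \<le> A * (B / A - B / A)\<^sup>2"
      unfolding sq is_arg_min_linorder by (metis add_le_cancel_right)
    then show "h = B / A" using assms by (simp add: mult_le_0_iff)
  next
    assume "h = B / A"
    then show "is_arg_min (\<lambda>h. G + h\<^sup>2 * A - 2 * h * B) (\<lambda>_. True) h"
      unfolding sq is_arg_min_linorder using assms by simp
  qed
qed

section \<open>Positivity of the variance\<close>

text \<open>
  With \<open>m n = (x ^ n + y ^ n) / 2\<close>, the right-hand side is the sum over \<open>n \<ge> 1\<close> of
  \<open>(t * s ^ n - m n)\<^sup>2 / (s ^ n * n!)\<close>; the subtracted constants remove the term \<open>n = 0\<close>.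
\<close>

lemma exp_series_Cauchy_Schwarz:
  fixes s x y t :: real
  assumes "s > 0"
  shows "0 \<le> t\<^sup>2 * (exp s - 1) - 2 * t * ((exp x + exp y) / 2 - 1)
    + ((exp (x\<^sup>2 / s) + exp (y\<^sup>2 / s) + 2 * exp (x * y / s)) / 4 - 1)"
proof -
  have E: "(\<lambda>n. z ^ n / fact n) sums exp z" for z :: real
    using exp_converges[of z] by (simp add: divide_inverse mult.commute)
  define w where "w n = t\<^sup>2 * (s ^ n / fact n) - 2 * t * ((x ^ n / fact n + y ^ n / fact n) / 2)
    + ((x\<^sup>2 / s) ^ n / fact n + (y\<^sup>2 / s) ^ n / fact n + 2 * ((x * y / s) ^ n / fact n)) / 4" for n :: nat
  define W where "W = t\<^sup>2 * exp s - 2 * t * ((exp x + exp y) / 2)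
    + (exp (x\<^sup>2 / s) + exp (y\<^sup>2 / s) + 2 * exp (x * y / s)) / 4"
  have "w sums W"
    unfolding w_def W_def by (intro sums_add sums_diff sums_mult sums_divide E)
  moreover have "w n = (t * s ^ n - (x ^ n + y ^ n) / 2)\<^sup>2 / (s ^ n * fact n)" for n
    using assms by (simp add: w_def power_divide power_mult_distrib field_simps power2_eq_square)
  then have "w n \<ge> 0" for n using assms by simp
  ultimately have "sum w {0} \<le> W"
    by (metis finite.emptyI finite.insertI sum_le_suminf sums_summable sums_unique)
  then show ?thesis
    by (simp add: w_def W_def field_simps power2_eq_square)
qed

text \<open>AM-GM for the squares of \<open>exp (u / 2)\<close> and
  \<open>exp (v / 2)\<close>.\<close>

lemma exp_midpoint_le: "2 * exp ((u + v) / 2) \<le> exp u + exp (v :: real)"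
proof -
  have "exp ((u + v) / 2) = exp (u / 2) * exp (v / 2)" by (simp add: add_divide_distrib exp_add)
  moreover have "exp u = exp (u / 2) ^ 2" "exp v = exp (v / 2) ^ 2"
    by (simp_all add: power2_eq_square flip: exp_add)
  ultimately show ?thesis using sum_squares_bound[of "exp (u / 2)" "exp (v / 2)"] by simp
qed

section \<open>Moments of the lognormal pair\<close>

locale lognormal_pair =
  fixes \<sigma>A \<sigma>B \<rho> T :: real
  assumes \<sigma>A_pos: "\<sigma>A > 0" and \<sigma>B_pos: "\<sigma>B > 0" and T_pos: "T > 0"
    and \<rho>_gt: "-1 < \<rho>" and \<rho>_lt: "\<rho> < 1"
begin

text \<open>For the log prices at time \<open>T\<close>, \<open>a\<close> and \<open>b\<close> are
  the variances, \<open>r\<close> is the covariance and \<open>s\<close> is the variance of their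
  mean; \<open>exp (- f)\<close> is the expectation of the geometric mean.\<close>

definition a where "a = \<sigma>A\<^sup>2 * T"
definition b where "b = \<sigma>B\<^sup>2 * T"
definition r where "r = \<rho> * \<sigma>A * \<sigma>B * T"
definition f where "f = (a + b - 2 * r) / 8"
definition s where "s = (a + b + 2 * r) / 4"
text \<open>The covariance of the geometric and arithmetic means, divided by
  \<open>exp (- f)\<close>. Each exponent is the covariance of one log price with the mean log
  price.\<close>

definition X where "X = (exp ((a + r) / 2) + exp ((b + r) / 2)) / 2 - 1"

lemma cov_det_pos: "a * b - r\<^sup>2 > 0"
proof -
  have "a * b - r\<^sup>2 = (\<sigma>A * \<sigma>B * T)\<^sup>2 * (1 - \<rho>\<^sup>2)"
    by (simp add: a_def b_def r_def power2_eq_square algebra_simps)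
  moreover have "1 - \<rho>\<^sup>2 > 0" using \<rho>_gt \<rho>_lt abs_square_less_1[of \<rho>] by auto
  ultimately show ?thesis using \<sigma>A_pos \<sigma>B_pos T_pos by simp
qed

text \<open>\<open>(a + b)\<^sup>2 - (2 * r)\<^sup>2\<close> is \<open>(a - b)\<^sup>2\<close> plus
  four times the covariance determinant.\<close>

lemma f_pos: "f > 0" and s_pos: "s > 0"
proof -
  have ab: "a > 0" "b > 0" using \<sigma>A_pos \<sigma>B_pos T_pos by (simp_all add: a_def b_def)
  have "(2 * r)\<^sup>2 < (a + b)\<^sup>2"
    using cov_det_pos zero_le_power2[of "a - b"] by (simp add: power2_eq_square algebra_simps)
  then have "\<bar>2 * r\<bar> < a + b"
    using ab power2_less_imp_less[of "\<bar>2 * r\<bar>" "a + b"] by (simp add: power2_abs)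
  then show "f > 0" "s > 0" by (simp_all add: f_def s_def)
qed

text \<open>This is the variance of a lognormal variable with mean \<open>exp (- f)\<close> and
  log-variance \<open>s\<close>; the exponents match because \<open>r = s - 2 * f\<close>.\<close>

lemma v_GG_eq: "v_GG \<sigma>A \<sigma>B \<rho> T = exp (- f) ^ 2 * (exp s - 1)"
proof -
  have "r = - f + - f + s" "- 2 * phi \<sigma>A \<sigma>B \<rho> * T = - f + - f"
    by (simp_all add: s_def f_def a_def b_def r_def phi_def field_simps)
  then have "exp r = exp (- f) * exp (- f) * exp s" "exp (- 2 * phi \<sigma>A \<sigma>B \<rho> * T) = exp (- f) * exp (- f)"
    by (simp_all only: exp_add)
  then show ?thesis
    unfolding v_GG_def r_def[symmetric] by (simp only: power2_eq_square right_diff_distrib mult_1_right)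
qed

lemma v_GA_eq: "v_GA \<sigma>A \<sigma>B \<rho> T = exp (- f) * X"
proof -
  have "(3 * \<sigma>A\<^sup>2 - \<sigma>B\<^sup>2 + 6 * \<rho> * \<sigma>A * \<sigma>B) * T / 8 = - f + (a + r) / 2"
    "(- \<sigma>A\<^sup>2 + 3 * \<sigma>B\<^sup>2 + 6 * \<rho> * \<sigma>A * \<sigma>B) * T / 8 = - f + (b + r) / 2"
    "- phi \<sigma>A \<sigma>B \<rho> * T = - f"
    by (simp_all add: f_def a_def b_def r_def phi_def field_simps)
  then show ?thesis
    unfolding v_GA_def X_def by (simp only: exp_add) (simp add: field_simps)
qed

lemma v_AA_eq: "v_AA \<sigma>A \<sigma>B \<rho> T = (exp a + exp b + 2 * exp r) / 4 - 1"
  by (simp add: v_AA_def a_def b_def r_def field_simps)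

text \<open>The exponents in \<open>X\<close> have midpoint \<open>s > 0\<close>, so their
  exponentials average to more than \<open>1\<close>.\<close>

lemma X_pos: "X > 0"
proof -
  have "2 * exp (((a + r) / 2 + (b + r) / 2) / 2) \<le> exp ((a + r) / 2) + exp ((b + r) / 2)"
    by (rule exp_midpoint_le)
  also have "((a + r) / 2 + (b + r) / 2) / 2 = s" by (simp add: s_def field_simps)
  finally have "2 * exp s \<le> exp ((a + r) / 2) + exp ((b + r) / 2)" .
  moreover have "exp s > 1" using s_pos by simp
  moreover have "0 < (u + v) / 2 - 1" if "2 * e \<le> u + v" "1 < e" for u v e :: real
    using that by simp
  ultimately show ?thesis unfolding X_def by blast
qed

text \<open>Each exponent in \<open>X\<close> is the midpoint of \<open>r\<close> with
  \<open>a\<close> or \<open>b\<close>.\<close>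

lemma X_le_v_AA: "X \<le> v_AA \<sigma>A \<sigma>B \<rho> T"
  using exp_midpoint_le[of a r] exp_midpoint_le[of b r] by (simp add: v_AA_eq X_def)

lemma v_AA_pos: "v_AA \<sigma>A \<sigma>B \<rho> T > 0"
  using X_pos X_le_v_AA by simp

lemma v_GA_less_v_AA: "v_GA \<sigma>A \<sigma>B \<rho> T < v_AA \<sigma>A \<sigma>B \<rho> T"
proof -
  have "exp (- f) * X < 1 * X" using f_pos X_pos by (intro mult_strict_right_mono) auto
  with X_le_v_AA show ?thesis by (simp add: v_GA_eq)
qed

text \<open>
  The lower bound is the second moment of the projections of the two log prices on their mean:
  the residual covariance is \<open>\<delta>\<close> on the diagonal and \<open>- \<delta>\<close> off it.
\<close>

lemma v_AA_gt_projection: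
  defines "x \<equiv> (a + r) / 2" and "y \<equiv> (b + r) / 2"
  shows "(exp (x\<^sup>2 / s) + exp (y\<^sup>2 / s) + 2 * exp (x * y / s)) / 4 - 1 < v_AA \<sigma>A \<sigma>B \<rho> T"
proof -
  define \<delta> where "\<delta> = (a * b - r\<^sup>2) / (4 * s)"
  define \<alpha> \<beta> \<gamma> where "\<alpha> = exp (x\<^sup>2 / s)" and "\<beta> = exp (y\<^sup>2 / s)" and "\<gamma> = exp (x * y / s)"
  have \<delta>: "\<delta> > 0" using cov_det_pos s_pos by (simp add: \<delta>_def)
  have "s * a = x\<^sup>2 + s * \<delta>" "s * b = y\<^sup>2 + s * \<delta>" "s * r = x * y - s * \<delta>"
    using s_pos by (simp_all add: \<delta>_def x_def y_def)
      (simp_all add: s_def field_simps power2_eq_square)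
  then have "a = x\<^sup>2 / s + \<delta>" "b = y\<^sup>2 / s + \<delta>" "r = x * y / s + - \<delta>"
    using s_pos by (simp_all add: field_simps)
  then have e: "exp a = \<alpha> * exp \<delta>" "exp b = \<beta> * exp \<delta>" "exp r = \<gamma> * exp (- \<delta>)"
    unfolding \<alpha>_def \<beta>_def \<gamma>_def by (simp_all only: exp_add)
  \<comment> \<open>Passing to the full moments raises the diagonal part by
    \<open>(\<alpha> + \<beta>) * (exp \<delta> - 1)\<close> and lowers the rest by
    \<open>2 * \<gamma> * (1 - exp (- \<delta>))\<close>; the gain wins since
    \<open>2 * \<gamma> \<le> \<alpha> + \<beta>\<close>.\<close>
  have "x * y / s \<le> (x\<^sup>2 / s + y\<^sup>2 / s) / 2"
    using s_pos sum_squares_bound[of x y] by (simp add: field_simps)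
  then have "2 * \<gamma> \<le> 2 * exp ((x\<^sup>2 / s + y\<^sup>2 / s) / 2)" by (simp add: \<gamma>_def)
  also have "\<dots> \<le> \<alpha> + \<beta>" unfolding \<alpha>_def \<beta>_def by (rule exp_midpoint_le)
  finally have "2 * \<gamma> * (exp \<delta> - 1) \<le> (\<alpha> + \<beta>) * (exp \<delta> - 1)"
    using \<delta> by (intro mult_right_mono) auto
  moreover have "2 * \<gamma> * (1 - exp (- \<delta>)) < 2 * \<gamma> * (exp \<delta> - 1)"
  proof -
    have "1 - exp (- \<delta>) = exp (- \<delta>) * (exp \<delta> - 1)"
      by (simp add: algebra_simps flip: exp_add)
    also have "\<dots> < 1 * (exp \<delta> - 1)" using \<delta> by (intro mult_strict_right_mono) auto
    finally show ?thesis by (simp add: \<gamma>_def)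
  qed
  ultimately have "\<alpha> + \<beta> + 2 * \<gamma> < \<alpha> * exp \<delta> + \<beta> * exp \<delta> + 2 * (\<gamma> * exp (- \<delta>))"
    by (simp add: algebra_simps)
  then show ?thesis
    unfolding v_AA_eq e by (simp add: \<alpha>_def \<beta>_def \<gamma>_def)
qed

text \<open>Cauchy-Schwarz gives nonnegativity with the projected moments in place of
  \<open>v_AA\<close>; the residual covariance makes it strict.\<close>

lemma hedge_var_pos: "hedge_var \<sigma>A \<sigma>B \<rho> T h > 0"
proof (cases "h = 0")
  case True
  then show ?thesis using s_pos by (simp add: hedge_var_def v_GG_eq)
next
  case False
  \<comment> \<open>With this scale the form in \<open>t\<close>, multiplied by
    \<open>h\<^sup>2\<close>, is the variance.\<close>
  define t where "t = exp (- f) / h"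
  have "0 < t\<^sup>2 * (exp s - 1) - 2 * t * X + v_AA \<sigma>A \<sigma>B \<rho> T"
    using exp_series_Cauchy_Schwarz[OF s_pos, of t "(a + r) / 2" "(b + r) / 2"]
      v_AA_gt_projection unfolding X_def by linarith
  then have "0 < h\<^sup>2 * (t\<^sup>2 * (exp s - 1) - 2 * t * X + v_AA \<sigma>A \<sigma>B \<rho> T)"
    using False by simp
  also have "\<dots> = hedge_var \<sigma>A \<sigma>B \<rho> T h"
    using False unfolding hedge_var_def v_GG_eq v_GA_eq t_def
    by (simp add: field_simps power2_eq_square)
  finally show ?thesis .
qed

lemma hedge_var_arg_min_iff:
  "is_arg_min (hedge_var \<sigma>A \<sigma>B \<rho> T) (\<lambda>_. True) h \<longleftrightarrow> h = v_GA \<sigma>A \<sigma>B \<rho> T / v_AA \<sigma>A \<sigma>B \<rho> T"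
  using is_arg_min_quadratic_iff[OF v_AA_pos] unfolding hedge_var_def .

text \<open>The minimizer is unique, so the choice inside \<open>arg_min\<close> is
  determined.\<close>

lemma h_mv_eq: "h_mv \<sigma>A \<sigma>B \<rho> T = v_GA \<sigma>A \<sigma>B \<rho> T / v_AA \<sigma>A \<sigma>B \<rho> T"
  unfolding h_mv_def arg_min_def hedge_var_arg_min_iff by simp

end

text \<open>A maximizer over the unit interval may sit at the corner \<open>0\<close>, where the
  derivative need only be nonpositive; hence the condition \<open>h \<noteq> 0\<close> there, but
  not for maximizers over all reals.\<close>

theorem theorem4:
  fixes \<sigma>A \<sigma>B \<rho> V0 T R C rf rA rB :: real
    and vGG vAA vGA \<mu> c hstar :: real and SR :: "real \<Rightarrow> real"
  assumes "\<sigma>A > 0" and "\<sigma>B > 0" and "V0 > 0" and "T > 0"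
    and "-1 < \<rho>" and "\<rho> < 1"
    and vGG: "vGG = v_GG \<sigma>A \<sigma>B \<rho> T"
    and vAA: "vAA = v_AA \<sigma>A \<sigma>B \<rho> T"
    and vGA: "vGA = v_GA \<sigma>A \<sigma>B \<rho> T"
    and \<mu>: "\<mu> = mu0 \<sigma>A \<sigma>B \<rho> V0 T R C rf"
    and c: "c = borrow_cost V0 T rA rB"
    and SR: "SR = sharpe_ratio \<sigma>A \<sigma>B \<rho> V0 T R C rf rA rB"
    and hstar: "hstar = (\<mu> * vGA - c * vGG) / (\<mu> * vAA - c * vGA)"
    and "\<mu> > 0"
  shows
    "(c > 0 \<longrightarrow>
        (\<exists>!h. is_arg_max SR (\<lambda>x. x \<in> {0..1}) h) \<and>
        (\<forall>h. (is_arg_max SR (\<lambda>x. x \<in> {0..1}) h \<and> h \<noteq> 0) \<or> is_arg_max SR (\<lambda>_. True) h \<longrightarrow>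
             h * (\<mu> * vAA - c * vGA) = \<mu> * vGA - c * vGG \<and>
             \<mu> * vAA - c * vGA \<noteq> 0 \<and>
             (\<forall>x. x * (\<mu> * vAA - c * vGA) = \<mu> * vGA - c * vGG \<longleftrightarrow> x = hstar))) \<and>
     (c = 0 \<longrightarrow>
        \<mu> * vAA - c * vGA \<noteq> 0 \<and>
        (\<forall>x. x * (\<mu> * vAA - c * vGA) = \<mu> * vGA - c * vGG \<longleftrightarrow> x = hstar) \<and>
        hstar = h_mv \<sigma>A \<sigma>B \<rho> T) \<and>
     h_mv \<sigma>A \<sigma>B \<rho> T = vGA / vAA \<and> vAA > 0 \<and>
     (\<forall>h. is_arg_min (hedge_var \<sigma>A \<sigma>B \<rho> T) (\<lambda>_. True) h \<longleftrightarrow> h = h_mv \<sigma>A \<sigma>B \<rho> T)"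
proof -
  interpret P: lognormal_pair \<sigma>A \<sigma>B \<rho> T using assms by unfold_locales
  have hv: "hedge_var \<sigma>A \<sigma>B \<rho> T h = vGG + h\<^sup>2 * vAA - 2 * h * vGA" for h
    by (simp add: hedge_var_def vGG vAA vGA)
  have A: "vAA > 0" and BA: "vGA < vAA"
    using P.v_AA_pos P.v_GA_less_v_AA by (simp_all add: vAA vGA)
  \<comment> \<open>The locale fixes no sign of \<open>c\<close>, so the interpretation precedes the
    split into \<open>c > 0\<close> and \<open>c = 0\<close>.\<close>
  interpret S: affine_over_sqrt_quadratic vGG vAA vGA \<mu> c V0
    using P.hedge_var_pos A \<open>\<mu> > 0\<close> \<open>V0 > 0\<close> by unfold_locales (simp_all flip: hv)
  have SR_eq: "SR = S.ratio"
    by (rule ext) (simp add: SR sharpe_ratio_def S.ratio_def S.Q_def hv flip: \<mu> c)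
  have solution: "\<forall>x. x * (\<mu> * vAA - c * vGA) = \<mu> * vGA - c * vGG \<longleftrightarrow> x = hstar"
    if "\<mu> * vAA - c * vGA \<noteq> 0"
    using that unfolding hstar by (auto simp: eq_divide_eq)
  have foc: "h * S.K = S.L"
    if "c > 0" and h: "(is_arg_max SR (\<lambda>x. x \<in> {0..1}) h \<and> h \<noteq> 0) \<or> is_arg_max SR (\<lambda>_. True) h" for h
    using h
  proof
    assume "is_arg_max SR (\<lambda>x. x \<in> {0..1}) h \<and> h \<noteq> 0"
    then show ?thesis
      using S.max_unit_first_order[OF \<open>c > 0\<close> BA]
      unfolding SR_eq is_arg_max_linorder by blast
  next
    assume "is_arg_max SR (\<lambda>_. True) h"
    then show ?thesis
      using S.local_max_first_order[of 1 h] unfolding SR_eq is_arg_max_linorder by simp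
  qed
  have pos: "(\<exists>!h. is_arg_max SR (\<lambda>x. x \<in> {0..1}) h) \<and>
        (\<forall>h. (is_arg_max SR (\<lambda>x. x \<in> {0..1}) h \<and> h \<noteq> 0) \<or> is_arg_max SR (\<lambda>_. True) h \<longrightarrow>
             h * (\<mu> * vAA - c * vGA) = \<mu> * vGA - c * vGG \<and>
             \<mu> * vAA - c * vGA \<noteq> 0 \<and>
             (\<forall>x. x * (\<mu> * vAA - c * vGA) = \<mu> * vGA - c * vGG \<longleftrightarrow> x = hstar))"
    if "c > 0"
    using S.ex1_max_unit[OF that BA] foc[OF that] S.first_order_imp_K_nonzero solution
    unfolding SR_eq S.K_def S.L_def by blast
  have free: "\<mu> * vAA - c * vGA \<noteq> 0 \<and>
        (\<forall>x. x * (\<mu> * vAA - c * vGA) = \<mu> * vGA - c * vGG \<longleftrightarrow> x = hstar) \<and>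
        hstar = h_mv \<sigma>A \<sigma>B \<rho> T" if "c = 0"
  proof -
    have "\<mu> * vAA - c * vGA \<noteq> 0" using that A \<open>\<mu> > 0\<close> by simp
    moreover have "hstar = h_mv \<sigma>A \<sigma>B \<rho> T"
      using that \<open>\<mu> > 0\<close> by (simp add: hstar P.h_mv_eq vAA vGA)
    ultimately show ?thesis using solution by blast
  qed
  have mv: "h_mv \<sigma>A \<sigma>B \<rho> T = vGA / vAA"
    by (simp add: P.h_mv_eq vAA vGA)
  have "is_arg_min (hedge_var \<sigma>A \<sigma>B \<rho> T) (\<lambda>_. True) h \<longleftrightarrow> h = h_mv \<sigma>A \<sigma>B \<rho> T" for h
    by (simp add: P.hedge_var_arg_min_iff P.h_mv_eq)
  then show ?thesis
    using pos free A mv by blast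
qed

end
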